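(* As polynomials in $x$ and $y$ with coefficients in the group algebra of $G_{r,n}$, $$\phi(x)\phi(y)=\phi(rxy+x+y).$$
   Context: Let $r,n\ge 1$. Write $i_c$ for a letter $i$ with color $c\in\{0,1,\ldots,r-1\}$, and order colored letters by color first and then by value: $i_c<j_d$ iff $c<d$, or $c=d$ and $i<j$. The group $G_{r,n}$ of $r$-colored permutations is the group of all bijections $\pi$ of $\{i_c:1\le i\le n,\ 0\le c\le r-1\}$ such that $\pi(i_0)=k_l$ implies $\pi(i_a)=k_{l+a}$ for all $a$ (colors modulo $r$), under composition. Such $\pi$ is identified with the word $\pi(1)\cdots\pi(n)$ where $\pi(i):=\pi(i_0)$; if $\tau(i)=j_k$ and $\sigma(j)=l_p$ then $(\sigma\tau)(i)=l_{k+p}$, color taken mod $r$. The descent number $\mathrm{des}(\pi)$ is the number of $i\in\{1,\ldots,n\}$ with $\pi(i)>\pi(i+1)$, where $\pi(n+1):=0_1$ (so $n$ is a descent iff the color of $\pi(n)$ is nonzero). Define $$\phi(x)=\sum_{\pi\in G_{r,n}}\binom{x+n-\mathrm{des}(\pi)}{n}\pi,$$ a polynomial in $x$ with coefficients in $\mathbb{Q}[G_{r,n}]$, where $\binom{z}{n}=z(z-1)\cdots(z-n+1)/n!$. *)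

theory Defs
  imports Complex_Main "HOL-Library.Poly_Mapping" "HOL-Combinatorics.Permutations" "HOL-Combinatorics.Perm"
begin

unbundle permutation_syntax

text \<open>The letter \<open>i\<close> with color \<open>c\<close> is the pair \<open>(i, c)\<close>; since the color is compared
  first, the order is not the lexicographic order on pairs.\<close>

type_synonym letter = "nat \<times> nat"

definition letter_less :: "letter \<Rightarrow> letter \<Rightarrow> bool" where
  "letter_less x y \<longleftrightarrow> snd x < snd y \<or> (snd x = snd y \<and> fst x < fst y)"

definition letters :: "nat \<Rightarrow> nat \<Rightarrow> letter set" where
  "letters r n = {1..n} \<times> {0..<r}"

text \<open>A bijection of \<^term>\<open>letters r n\<close> is represented by its extension by the identity to all
  pairs, so that composition is the multiplication of type \<^typ>\<open>letter perm\<close>.\<close>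

definition colored_perms :: "nat \<Rightarrow> nat \<Rightarrow> letter perm set" where
  "colored_perms r n = {\<pi>. affected \<pi> \<subseteq> letters r n \<and>
     (\<forall>i\<in>{1..n}. \<forall>k l. \<pi> \<langle>$\<rangle> (i, 0) = (k, l) \<longrightarrow>
        (\<forall>a\<in>{0..<r}. \<pi> \<langle>$\<rangle> (i, a) = (k, (l + a) mod r)))}"

text \<open>The final letter \<open>0\<^sub>1\<close> keeps color \<open>1\<close> also when \<open>r = 1\<close> (it is not reduced modulo \<open>r\<close>).\<close>

definition word :: "nat \<Rightarrow> letter perm \<Rightarrow> nat \<Rightarrow> letter" where
  "word n \<pi> i = (if i \<le> n then \<pi> \<langle>$\<rangle> (i, 0) else (0, 1))"

definition des :: "nat \<Rightarrow> letter perm \<Rightarrow> nat" where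
  "des n \<pi> = card {i\<in>{1..n}. letter_less (word n \<pi> (i + 1)) (word n \<pi> i)}"

lemma apply_in_letters_iff:
  assumes "affected \<pi> \<subseteq> letters r n"
  shows "\<pi> \<langle>$\<rangle> x \<in> letters r n \<longleftrightarrow> x \<in> letters r n"
proof (cases "x \<in> affected \<pi>")
  case True
  then have "\<pi> \<langle>$\<rangle> x \<in> affected \<pi>" by simp
  with True assms show ?thesis by blast
next
  case False
  then show ?thesis by (simp add: in_affected)
qed

lemma finite_colored_perms: "finite (colored_perms r n)"
proof -
  have "finite {f. f permutes letters r n}"
    by (rule finite_permutations) (simp add: letters_def)
  moreover have "apply ` colored_perms r n \<subseteq> {f. f permutes letters r n}"
  proof
    fix f assume "f \<in> apply ` colored_perms r n"
    then obtain \<pi> where "affected \<pi> \<subseteq> letters r n" "f = apply \<pi>"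
      by (auto simp: colored_perms_def)
    then have "bij f" "\<forall>x. x \<notin> letters r n \<longrightarrow> f x = x"
      by (auto simp: in_affected)
    then show "f \<in> {f. f permutes letters r n}"
      by (simp add: permutes_def bij_iff)
  qed
  ultimately have "finite (apply ` colored_perms r n)"
    by (rule finite_subset[rotated])
  then show ?thesis
    by (rule finite_imageD) (simp add: inj_on_def apply_inject)
qed

lemma colored_perms_times_apply:
  assumes "\<sigma> \<in> colored_perms r n" "i \<in> {1..n}" "r \<ge> 1"
    and "\<tau> \<in> colored_perms r n" "\<tau> \<langle>$\<rangle> (i, 0) = (j, k)" "\<sigma> \<langle>$\<rangle> (j, 0) = (l, p)"
  shows "(\<sigma> * \<tau>) \<langle>$\<rangle> (i, 0) = (l, (k + p) mod r)"
proof -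
  have "(i, 0) \<in> letters r n" using assms by (simp add: letters_def)
  then have "(j, k) \<in> letters r n"
    using apply_in_letters_iff[of \<tau> r n "(i, 0)"] assms(4,5) by (simp add: colored_perms_def)
  then have "j \<in> {1..n}" "k \<in> {0..<r}" by (simp_all add: letters_def)
  then have "\<sigma> \<langle>$\<rangle> (j, k) = (l, (p + k) mod r)"
    using assms(1,6) unfolding colored_perms_def by blast
  then show ?thesis
    using assms(5) by (simp add: apply_times add.commute)
qed

lemma one_in_colored_perms: "1 \<in> colored_perms r n"
  by (simp add: colored_perms_def)

lemma times_in_colored_perms:
  assumes s: "\<sigma> \<in> colored_perms r n" and t: "\<tau> \<in> colored_perms r n"
  shows "\<sigma> * \<tau> \<in> colored_perms r n"
proof -
  have "affected (\<sigma> * \<tau>) \<subseteq> letters r n"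
    using s t affected_times[of \<sigma> \<tau>] unfolding colored_perms_def by blast
  moreover have "(\<sigma> * \<tau>) \<langle>$\<rangle> (i, a) = (k, (l + a) mod r)"
    if i: "i \<in> {1..n}" and kl: "(\<sigma> * \<tau>) \<langle>$\<rangle> (i, 0) = (k, l)" and a: "a \<in> {0..<r}" for i k l a
  proof -
    obtain j b where jb: "\<tau> \<langle>$\<rangle> (i, 0) = (j, b)" by fastforce
    obtain l' p where lp: "\<sigma> \<langle>$\<rangle> (j, 0) = (l', p)" by fastforce
    have r: "r \<ge> 1" using a by simp
    have eq: "k = l'" "l = (b + p) mod r"
      using colored_perms_times_apply[OF s i r t jb lp] kl by simp_all
    have "(i, 0) \<in> letters r n" using i r by (simp add: letters_def)
    moreover have "affected \<tau> \<subseteq> letters r n" using t by (simp add: colored_perms_def)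
    ultimately have "(j, b) \<in> letters r n"
      using apply_in_letters_iff[of \<tau> r n "(i, 0)"] jb by simp
    then have j: "j \<in> {1..n}" by (simp add: letters_def)
    have "\<tau> \<langle>$\<rangle> (i, a) = (j, (b + a) mod r)"
      using t i jb a unfolding colored_perms_def by blast
    moreover have "\<sigma> \<langle>$\<rangle> (j, (b + a) mod r) = (l', (p + (b + a) mod r) mod r)"
    proof -
      have "(b + a) mod r \<in> {0..<r}" using r by simp
      then show ?thesis using s j lp unfolding colored_perms_def by blast
    qed
    ultimately show ?thesis
      by (simp add: apply_times eq mod_simps ac_simps)
  qed
  ultimately show ?thesis unfolding colored_perms_def by blast
qed

lemma inverse_in_colored_perms:
  assumes "\<pi> \<in> colored_perms r n"
  shows "inverse \<pi> \<in> colored_perms r n"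
proof -
  have "(\<lambda>\<sigma>. \<pi> * \<sigma>) ` colored_perms r n = colored_perms r n"
    using assms by (intro endo_inj_surj)
      (auto simp: finite_colored_perms inj_on_def perm.left_cancel intro: times_in_colored_perms)
  then have "1 \<in> (\<lambda>\<sigma>. \<pi> * \<sigma>) ` colored_perms r n"
    using one_in_colored_perms[of r n] by simp
  then obtain \<sigma> where "\<sigma> \<in> colored_perms r n" "\<pi> * \<sigma> = 1"
    by (metis imageE)
  then show ?thesis
    using perm.inverse_unique[of \<pi> \<sigma>] by simp
qed

text \<open>The product of \<^typ>\<open>'k \<Rightarrow>\<^sub>0 'a\<close> is convolution with respect to addition of the keys. The
  wrapper turns the multiplication of a monoid into such an addition, so that
  \<open>'g expo \<Rightarrow>\<^sub>0 rat\<close> is the algebra of \<open>'g\<close>. In it, the elements supported on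
  \<^term>\<open>colored_perms r n\<close> form the group algebra of this subgroup of \<^typ>\<open>letter perm\<close>.\<close>

datatype 'g expo = Expo 'g

instantiation expo :: (monoid_mult) monoid_add
begin

definition zero_expo :: "'a expo" where
  "zero_expo = Expo 1"

fun plus_expo :: "'a expo \<Rightarrow> 'a expo \<Rightarrow> 'a expo" where
  "plus_expo (Expo g) (Expo h) = Expo (g * h)"

instance
proof
  fix a b c :: "'a expo"
  show "a + b + c = a + (b + c)"
    by (cases a; cases b; cases c) (simp add: mult.assoc)
  show "0 + a = a" "a + 0 = a"
    by (cases a; simp add: zero_expo_def)+
qed

end

type_synonym group_alg = "letter perm expo \<Rightarrow>\<^sub>0 rat"

lemma single_Expo_times:
  "Poly_Mapping.single (Expo g) a * Poly_Mapping.single (Expo h) b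
     = (Poly_Mapping.single (Expo (g * h)) (a * b) :: group_alg)"
  by (simp add: mult_single)

text \<open>A monomial is given by its exponents, finitely many of them nonzero; variables are numbered
  by natural numbers. The library's \<open>'a poly\<close> has a product for commutative \<open>'a\<close> only. The
  variables commute with each other and with all coefficients.\<close>

type_synonym alg_poly = "(nat \<Rightarrow>\<^sub>0 nat) \<Rightarrow>\<^sub>0 group_alg"

definition Var :: "nat \<Rightarrow> alg_poly" where
  "Var v = Poly_Mapping.single (Poly_Mapping.single v 1) 1"

definition Const :: "group_alg \<Rightarrow> alg_poly" where
  "Const a = Poly_Mapping.single 0 a"

definition scalar :: "rat \<Rightarrow> group_alg" where
  "scalar q = Poly_Mapping.single 0 q"

definition basis :: "letter perm \<Rightarrow> group_alg" where
  "basis \<pi> = Poly_Mapping.single (Expo \<pi>) 1"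

text \<open>\<open>prod\<close> and \<open>gchoose\<close> are not available in a noncommutative ring.\<close>

definition binom :: "alg_poly \<Rightarrow> nat \<Rightarrow> alg_poly" where
  "binom z n = Const (scalar (1 / fact n)) * prod_list (map (\<lambda>i. z - of_nat i) [0..<n])"

definition phi :: "nat \<Rightarrow> nat \<Rightarrow> alg_poly \<Rightarrow> alg_poly" where
  "phi r n x = (\<Sum>\<pi>\<in>colored_perms r n. binom (x + of_nat n - of_nat (des n \<pi>)) n * Const (basis \<pi>))"

end

theory Submission
  imports Defs "HOL-Library.FuncSet" "HOL-Library.Infinite_Set" "HOL-Computational_Algebra.Polynomial"
begin

text \<open>For a natural number \<open>a\<close>, the coefficient of \<open>\<pi>\<close> in \<open>\<phi>(a)\<close> counts the labellings
  \<open>f : {1..n} \<rightarrow> {0..r a}\<close> sorted by \<open>\<pi>\<close>, that is, \<open>\<pi>\<close> lists the values \<open>k\<close> in increasing order of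
  \<open>(f k, k)\<close> and gives \<open>k\<close> the color \<open>f k mod r\<close>; every labelling is sorted by exactly one \<open>\<pi>\<close>.
  If \<open>\<sigma>\<close> sorts \<open>f\<close> and \<open>\<tau>\<close> sorts \<open>g\<close>, with bounds \<open>r a\<close> and \<open>r b\<close>, then \<open>\<sigma>\<tau>\<close> sorts the
  labelling \<open>h\<close> which gives the value \<open>\<bar>\<sigma>(t)\<bar>\<close> the label \<open>(r a + 1) g(t) + f(\<bar>\<sigma>(t)\<bar>)\<close>.
  By division with remainder \<open>(f, g) \<mapsto> h\<close> is a bijection onto the labellings bounded by
  \<open>r (r a b + a + b)\<close>. This proves the identity at natural numbers, hence as polynomials.\<close>

section \<open>Counting bounded chains with prescribed strict steps\<close>

definition weak_chains :: "(nat \<Rightarrow> nat) \<Rightarrow> nat \<Rightarrow> nat \<Rightarrow> (nat \<Rightarrow> nat) set" where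
  "weak_chains \<delta> n M = {q \<in> {1..n} \<rightarrow>\<^sub>E UNIV.
     \<forall>s\<in>{1..n}. q s + \<delta> s \<le> (if s = n then M else q (Suc s))}"

text \<open>Hockey-stick summation: telescoping leaves the lower boundary term
  \<open>K choose (n + 1)\<close>, which vanishes because \<open>K \<le> n\<close>.\<close>

lemma sum_shifted_binomial:
  fixes K n N :: nat
  assumes "K \<le> n"
  shows "(\<Sum>m\<le>N. (m + K) choose n) = (N + K + 1) choose (n + 1)"
  using assms by (induction N) (auto simp: binomial_eq_0_iff le_less)

text \<open>Splitting off the last value \<open>m\<close> works because \<open>m\<close> then serves
  as the upper bound of the remaining chain.\<close>

lemma weak_chains_Suc:
  "weak_chains \<delta> (Suc n) M =
     (\<lambda>(m, q). q(Suc n := m)) ` (SIGMA m:{m. m + \<delta> (Suc n) \<le> M}. weak_chains \<delta> n m)"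
  (is "?L = ?F ` ?S")
proof
  show "?F ` ?S \<subseteq> ?L"
    by (auto simp: weak_chains_def PiE_def extensional_def)
  show "?L \<subseteq> ?F ` ?S"
  proof
    fix q assume q: "q \<in> ?L"
    then have "q = ?F (q (Suc n), restrict q {1..n})"
      by (auto simp: weak_chains_def PiE_def extensional_def fun_eq_iff)
    moreover have "(q (Suc n), restrict q {1..n}) \<in> ?S"
      using q by (force simp: weak_chains_def)
    ultimately show "q \<in> ?F ` ?S" by blast
  qed
qed

text \<open>Induction on the length: summing over the last value is a hockey-stick sum. Since every
  \<delta> is at most 1, their sum is at most \<open>n\<close>, so the subtraction is not
  truncated.\<close>

lemma finite_card_weak_chains:
  assumes "\<And>s. \<delta> s \<le> 1"
  shows "finite (weak_chains \<delta> n M) \<and> card (weak_chains \<delta> n M) = (M + n - (\<Sum>s=1..n. \<delta> s)) choose n"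
proof (induction n arbitrary: M)
  case 0
  have "weak_chains \<delta> 0 M = {\<lambda>_. undefined}"
    by (auto simp: weak_chains_def)
  then show ?case by simp
next
  case (Suc n)
  define D where "D = (\<Sum>s=1..n. \<delta> s)"
  have D: "D \<le> n"
    using sum_bounded_above[of "{1..n}" \<delta> 1] assms by (simp add: D_def)
  let ?I = "{m. m + \<delta> (Suc n) \<le> M}"
  have fin: "finite ?I" by (rule finite_subset[of _ "{..M}"]) auto
  have inj: "inj_on (\<lambda>(m, q). q(Suc n := m)) (SIGMA m:?I. weak_chains \<delta> n m)"
  proof (rule inj_onI, clarify)
    fix m q m' q'
    assume q: "q \<in> weak_chains \<delta> n m" "q' \<in> weak_chains \<delta> n m'" and eq: "q(Suc n := m) = q'(Suc n := m')"
    have "q (Suc n) = undefined" "q' (Suc n) = undefined"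
      using q by (auto simp: weak_chains_def PiE_def extensional_def)
    \<comment> \<open>Chains are \<open>undefined\<close> outside \<open>{1..n}\<close>, so
      resetting the updated point recovers the shorter chain.\<close>
    then have "q = (q(Suc n := m))(Suc n := undefined)" "q' = (q'(Suc n := m'))(Suc n := undefined)"
      by (simp_all only: fun_upd_upd fun_upd_idem)
    then show "m = m' \<and> q = q'"
      using eq fun_cong[OF eq, of "Suc n"] by (metis fun_upd_same)
  qed
  have "card (weak_chains \<delta> (Suc n) M) = (\<Sum>m\<in>?I. (m + n - D) choose n)"
    unfolding weak_chains_Suc card_image[OF inj] using Suc.IH fin by (simp add: card_SigmaI D_def)
  also have "\<dots> = (M + Suc n - (D + \<delta> (Suc n))) choose Suc n"
  proof (cases "\<delta> (Suc n) \<le> M")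
    case True
    then have "?I = {..M - \<delta> (Suc n)}" by auto
    then have "(\<Sum>m\<in>?I. (m + n - D) choose n) = (\<Sum>m\<le>M - \<delta> (Suc n). (m + (n - D)) choose n)"
      using D by simp
    also have "\<dots> = (M - \<delta> (Suc n) + (n - D) + 1) choose (n + 1)"
      by (rule sum_shifted_binomial) simp
    also have "M - \<delta> (Suc n) + (n - D) + 1 = M + Suc n - (D + \<delta> (Suc n))"
      using True D by simp
    finally show ?thesis by simp
  next
    case False
    \<comment> \<open>Here \<open>M = 0\<close> and \<open>\<delta> (Suc n) = 1\<close>, so both
      sides are 0.\<close>
    then have "?I = {}" "M + Suc n - (D + \<delta> (Suc n)) < Suc n"
      by auto
    then show ?thesis by simp
  qed
  finally show ?case
    using Suc.IH fin by (simp add: weak_chains_Suc D_def)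
qed

section \<open>Labellings sorted by a given colored permutation\<close>

definition base :: "letter perm \<Rightarrow> nat \<Rightarrow> nat" where
  "base \<pi> s = fst (\<pi> \<langle>$\<rangle> (s, 0))"

definition col :: "letter perm \<Rightarrow> nat \<Rightarrow> nat" where
  "col \<pi> s = snd (\<pi> \<langle>$\<rangle> (s, 0))"

text \<open>Read a function \<open>f\<close> on \<open>{1..n}\<close> as a labelling of the values: the labels fix the colors
  modulo \<open>r\<close>, and the word lists the values in lexicographic order of \<open>(f k, k)\<close>, encoded in a
  single number.\<close>

definition sorts :: "nat \<Rightarrow> nat \<Rightarrow> letter perm \<Rightarrow> (nat \<Rightarrow> nat) \<Rightarrow> bool" where
  "sorts r n \<pi> f \<longleftrightarrow>
     strict_mono_on {1..n} (\<lambda>s. f (base \<pi> s) * (n + 1) + base \<pi> s) \<and>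
     (\<forall>s\<in>{1..n}. f (base \<pi> s) mod r = col \<pi> s)"

text \<open>The key is the pair written in base \<open>n + 1\<close> with low digit at most
  \<open>n\<close>, so the order of numbers is the lexicographic order of pairs.\<close>

lemma key_less_iff:
  fixes a b k l n :: nat
  assumes "k \<le> n" "l \<le> n"
  shows "a * (n + 1) + k < b * (n + 1) + l \<longleftrightarrow> a < b \<or> a = b \<and> k < l"
proof -
  have "a * (n + 1) + k < b * (n + 1) + l" if "a < b" "k \<le> n" for a b k l
    using mult_le_mono1[of "Suc a" b "n + 1"] that by simp
  then show ?thesis
    using assms by (metis add_less_cancel_left less_asym linorder_neqE_nat)
qed

lemma key_eq_iff:
  fixes a b k l n :: nat
  assumes "k \<le> n" "l \<le> n"
  shows "a * (n + 1) + k = b * (n + 1) + l \<longleftrightarrow> a = b \<and> k = l"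
  using key_less_iff[OF assms, of a b] key_less_iff[OF assms(2,1), of b a]
  by linarith

text \<open>This is where descents enter. For labels \<open>r * q + c\<close>, the quotient must
  strictly increase exactly when the first letter exceeds the second in the order by color, then
  value; otherwise it may stay equal.\<close>

lemma lex_less_iff:
  fixes q q' c c' k k' r :: nat
  assumes "c < r" "c' < r" "k \<noteq> k'"
  shows "r * q + c < r * q' + c' \<or> r * q + c = r * q' + c' \<and> k < k' \<longleftrightarrow>
    q + of_bool (c' < c \<or> c' = c \<and> k' < k) \<le> q'"
proof -
  have aux: "r * a + c < r * b + d" if "a < b" "c < r" for a b c d
    using mult_le_mono2[of "Suc a" b r] that by simp
  show ?thesis
  proof (cases q q' rule: linorder_cases)
    case less
    then show ?thesis using aux[OF less assms(1), of c'] by simp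
  next
    case equal
    then show ?thesis using assms(3) by simp linarith
  next
    case greater
    then show ?thesis using aux[OF greater assms(2), of c] by simp
  qed
qed

lemma strict_mono_on_consecutive:
  fixes g :: "nat \<Rightarrow> nat"
  assumes "\<And>s. 1 \<le> s \<Longrightarrow> s < n \<Longrightarrow> g s < g (Suc s)"
  shows "strict_mono_on {1..n} g"
proof (rule strict_mono_onI)
  fix s t assume st: "s \<in> {1..n}" "t \<in> {1..n}" "s < t"
  from \<open>s < t\<close> have "t \<le> n \<Longrightarrow> g s < g t"
    using \<open>s \<in> {1..n}\<close> 
    by (induction rule: less_Suc_induct) (use assms st in \<open>auto intro: less_trans\<close>)
  then show "g s < g t" using st by simp
qed

lemma colored_perms_letter:
  assumes "\<pi> \<in> colored_perms r n" "r \<ge> 1" "s \<in> {1..n}"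
  shows "base \<pi> s \<in> {1..n}" "col \<pi> s < r"
proof -
  have "(s, 0) \<in> letters r n" using assms by (simp add: letters_def)
  then have "\<pi> \<langle>$\<rangle> (s, 0) \<in> letters r n"
    using assms(1) apply_in_letters_iff[of \<pi> r n] by (simp add: colored_perms_def)
  then show "base \<pi> s \<in> {1..n}" "col \<pi> s < r"
    by (auto simp: letters_def base_def col_def mem_Times_iff)
qed

lemma colored_perms_apply:
  assumes "\<pi> \<in> colored_perms r n" "s \<in> {1..n}" "a < r"
  shows "\<pi> \<langle>$\<rangle> (s, a) = (base \<pi> s, (col \<pi> s + a) mod r)"
proof -
  have "\<forall>k l. \<pi> \<langle>$\<rangle> (s, 0) = (k, l) \<longrightarrow> (\<forall>a\<in>{0..<r}. \<pi> \<langle>$\<rangle> (s, a) = (k, (l + a) mod r))"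
    using assms(1,2) unfolding colored_perms_def by blast
  moreover have "\<pi> \<langle>$\<rangle> (s, 0) = (base \<pi> s, col \<pi> s)" by (simp only: base_def col_def prod.collapse)
  ultimately have "\<forall>a\<in>{0..<r}. \<pi> \<langle>$\<rangle> (s, a) = (base \<pi> s, (col \<pi> s + a) mod r)" by blast
  with assms(3) show ?thesis by simp
qed

lemma bij_betw_base:
  assumes "\<pi> \<in> colored_perms r n" "r \<ge> 1"
  shows "bij_betw (base \<pi>) {1..n} {1..n}"
proof -
  have "inj_on (base \<pi>) {1..n}"
  proof (rule inj_onI)
    fix s t assume st: "s \<in> {1..n}" "t \<in> {1..n}" "base \<pi> s = base \<pi> t"
    \<comment> \<open>The color that turns the letter at \<open>t\<close> into the letter at
      \<open>s\<close>; injectivity of the permutation on colored letters then applies.\<close>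
    define a where "a = (col \<pi> s + (r - col \<pi> t)) mod r"
    have "a < r" using assms by (simp add: a_def)
    have c: "col \<pi> s < r" "col \<pi> t < r" using colored_perms_letter assms st by auto
    then have "(col \<pi> t + a) mod r = col \<pi> s mod r"
      unfolding a_def mod_add_right_eq by (simp add: algebra_simps)
    then have "\<pi> \<langle>$\<rangle> (t, a) = \<pi> \<langle>$\<rangle> (s, 0)"
      using colored_perms_apply[OF assms(1) st(2) \<open>a < r\<close>] st(3) c
      by (simp add: base_def col_def prod_eq_iff)
    then show "s = t" by (simp add: apply_inj)
  qed
  moreover have "base \<pi> ` {1..n} \<subseteq> {1..n}"
    using colored_perms_letter assms by blast
  ultimately show ?thesis
    by (simp add: bij_betw_def endo_inj_surj)
qed

text \<open>This identifies the coefficient of \<pi> in \<open>phi\<close> at the natural number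
  \<open>M\<close> as a count. The quotients of the labels by \<open>r\<close>, read along the word,
  form a chain in \<open>weak_chains\<close> whose strict steps are the descents.\<close>

lemma card_sorts:
  assumes \<pi>: "\<pi> \<in> colored_perms r n" and r: "r \<ge> 1"
  shows "card {f \<in> {1..n} \<rightarrow>\<^sub>E {0..r * M}. sorts r n \<pi> f} = (M + n - des n \<pi>) choose n"
proof -
  define \<delta> where "\<delta> s = (of_bool (letter_less (word n \<pi> (s + 1)) (word n \<pi> s)) :: nat)" for s
  let ?f = "\<lambda>f s. f (base \<pi> s) * (n + 1) + base \<pi> s"
  note bij = bij_betw_base[OF \<pi> r]
  note in1 = colored_perms_letter[OF \<pi> r]
  have step: "?f f s < ?f f (Suc s) \<longleftrightarrow> q s + \<delta> s \<le> q (Suc s)"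
    if s: "1 \<le> s" "s < n" and f: "\<And>s. s \<in> {1..n} \<Longrightarrow> f (base \<pi> s) = r * q s + col \<pi> s" for f q s
  proof -
    have *: "base \<pi> s \<noteq> base \<pi> (Suc s)" using inj_onD[OF bij_betw_imp_inj_on[OF bij], of s "Suc s"] s by auto
    have **: "base \<pi> s \<in> {1..n}" "base \<pi> (Suc s) \<in> {1..n}" "col \<pi> s < r" "col \<pi> (Suc s) < r"
      using in1 s by auto
    have "?f f s < ?f f (Suc s) \<longleftrightarrow> r * q s + col \<pi> s < r * q (Suc s) + col \<pi> (Suc s) \<or>
      r * q s + col \<pi> s = r * q (Suc s) + col \<pi> (Suc s) \<and> base \<pi> s < base \<pi> (Suc s)"
      using ** s by (subst key_less_iff) (auto simp: f)
    also have "\<dots> \<longleftrightarrow> q s + of_bool (col \<pi> (Suc s) < col \<pi> s \<or>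
        col \<pi> (Suc s) = col \<pi> s \<and> base \<pi> (Suc s) < base \<pi> s) \<le> q (Suc s)"
      by (rule lex_less_iff) (use * ** in auto)
    also have "of_bool (col \<pi> (Suc s) < col \<pi> s \<or>
        col \<pi> (Suc s) = col \<pi> s \<and> base \<pi> (Suc s) < base \<pi> s) = \<delta> s"
      using s by (simp add: \<delta>_def letter_less_def word_def base_def col_def)
    finally show ?thesis .
  qed
  \<comment> \<open>The bound is a multiple of \<open>r\<close>, so a nonzero last color forces
    \<open>q < M\<close>. This is the descent at \<open>n\<close> caused by the final letter
    \<open>(0, 1)\<close>.\<close>
  have last: "r * q + col \<pi> n \<le> r * M \<longleftrightarrow> q + \<delta> n \<le> M" if "n \<ge> 1" for q
  proof -
    have c: "\<delta> n = of_bool (col \<pi> n > 0)" "col \<pi> n < r"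
      using in1[of n] that by (auto simp: \<delta>_def letter_less_def word_def base_def col_def)
    have "r * q + col \<pi> n \<le> r * M \<longleftrightarrow> q < M \<or> q = M \<and> col \<pi> n = 0"
    proof (cases q M rule: linorder_cases)
      case less
      then show ?thesis using mult_le_mono2[of "Suc q" M r] c by simp
    next
      case greater
      then show ?thesis using mult_le_mono2[of "Suc M" q r] c r by simp
    qed simp
    then show ?thesis using c by auto
  qed
  have char: "strict_mono_on {1..n} (?f f) \<and> (\<forall>s\<in>{1..n}. f (base \<pi> s) \<le> r * M) \<longleftrightarrow>
      (\<forall>s\<in>{1..n}. q s + \<delta> s \<le> (if s = n then M else q (Suc s)))" (is "?l \<longleftrightarrow> ?r")
    if f: "\<And>s. s \<in> {1..n} \<Longrightarrow> f (base \<pi> s) = r * q s + col \<pi> s" for f q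
  proof
    assume ?l
    show ?r
    proof
      fix s assume s: "s \<in> {1..n}"
      show "q s + \<delta> s \<le> (if s = n then M else q (Suc s))"
      proof (cases "s = n")
        case True
        then have "r * q n + col \<pi> n \<le> r * M" using \<open>?l\<close> f s by metis
        then show ?thesis using last True s by simp
      next
        case False
        then have "?f f s < ?f f (Suc s)"
          using \<open>?l\<close> s by (auto intro: strict_mono_onD)
        then show ?thesis using step[OF _ _ f, of s] s False by simp
      qed
    qed
  next
    assume ?r
    have mono: "strict_mono_on {1..n} (?f f)"
    proof (rule strict_mono_on_consecutive)
      fix s assume s: "1 \<le> s" "s < n"
      then show "?f f s < ?f f (Suc s)" using \<open>?r\<close>[rule_format, of s] step[OF _ _ f, of s] by (simp split: if_splits)
    qed
    moreover have "f (base \<pi> s) \<le> r * M" if s: "s \<in> {1..n}" for s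
    proof -
      \<comment> \<open>The chain condition bounds only the last label directly; increasing keys
        make the labels weakly increasing along the word.\<close>
      have "?f f s \<le> ?f f n"
        using strict_mono_on_leD[OF mono s, of n] s by simp
      then have "f (base \<pi> s) \<le> f (base \<pi> n)"
        using key_less_iff[of "base \<pi> n" n "base \<pi> s" "f (base \<pi> n)" "f (base \<pi> s)"] in1[of s] in1[of n] s
        by fastforce
      also have "\<dots> \<le> r * M" using last[of "q n"] f[of n] \<open>?r\<close>[rule_format, of n] s by simp
      finally show ?thesis .
    qed
    ultimately show ?l by blast
  qed
  let ?p = "inv_into {1..n} (base \<pi>)"
  have p: "?p k \<in> {1..n}" "base \<pi> (?p k) = k" if "k \<in> {1..n}" for k
    using that bij by (metis bij_betw_def inv_into_into, metis bij_betw_inv_into_right)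
  have p': "?p (base \<pi> s) = s" if "s \<in> {1..n}" for s
    using that bij by (metis bij_betw_inv_into_left)
  let ?A = "{f \<in> {1..n} \<rightarrow>\<^sub>E {0..r * M}. sorts r n \<pi> f}"
  let ?\<Phi> = "\<lambda>f. restrict (\<lambda>s. f (base \<pi> s) div r) {1..n}"
  let ?\<Psi> = "\<lambda>q. restrict (\<lambda>k. r * q (?p k) + col \<pi> (?p k)) {1..n}"
  \<comment> \<open>Writing labels as \<open>r * q + c\<close>, only the quotients are free, and they may stall exactly at non-descents.\<close>
  have "bij_betw ?\<Phi> ?A (weak_chains \<delta> n M)"
  proof (rule bij_betw_byWitness[where f' = ?\<Psi>])
    have decomp: "f (base \<pi> s) = r * (f (base \<pi> s) div r) + col \<pi> s"
      if "sorts r n \<pi> f" "s \<in> {1..n}" for f s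
      using that by (metis sorts_def mult_div_mod_eq)
    show "\<forall>f\<in>?A. ?\<Psi> (?\<Phi> f) = f"
    proof
      fix f assume f: "f \<in> ?A"
      show "?\<Psi> (?\<Phi> f) = f"
      proof
        fix k show "?\<Psi> (?\<Phi> f) k = f k"
          using f decomp[of f "?p k"] p[of k] by (cases "k \<in> {1..n}") (auto simp: PiE_def extensional_def)
      qed
    qed
    show "\<forall>q\<in>weak_chains \<delta> n M. ?\<Phi> (?\<Psi> q) = q"
    proof
      fix q assume q: "q \<in> weak_chains \<delta> n M"
      show "?\<Phi> (?\<Psi> q) = q"
      proof
        fix s show "?\<Phi> (?\<Psi> q) s = q s"
          using q in1[of s] p'[of s] by (cases "s \<in> {1..n}") (auto simp: weak_chains_def PiE_def extensional_def)
      qed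
    qed
    show "?\<Phi> ` ?A \<subseteq> weak_chains \<delta> n M"
    proof (rule image_subsetI)
      fix f assume f: "f \<in> ?A"
      then have "strict_mono_on {1..n} (?f f) \<and> (\<forall>s\<in>{1..n}. f (base \<pi> s) \<le> r * M)"
        using in1 by (fastforce simp: sorts_def)
      then have "\<forall>s\<in>{1..n}. f (base \<pi> s) div r + \<delta> s \<le> (if s = n then M else f (base \<pi> (Suc s)) div r)"
        using f by (subst (asm) char[of f "\<lambda>s. f (base \<pi> s) div r"]) (auto intro: decomp)
      then show "?\<Phi> f \<in> weak_chains \<delta> n M"
        by (fastforce simp: weak_chains_def)
    qed
    show "?\<Psi> ` weak_chains \<delta> n M \<subseteq> ?A"
    proof (rule image_subsetI)
      fix q assume q: "q \<in> weak_chains \<delta> n M"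
      have f: "?\<Psi> q (base \<pi> s) = r * q s + col \<pi> s" if "s \<in> {1..n}" for s
        using in1[OF that] p'[OF that] by simp
      have *: "strict_mono_on {1..n} (?f (?\<Psi> q)) \<and> (\<forall>s\<in>{1..n}. ?\<Psi> q (base \<pi> s) \<le> r * M)"
        using q by (subst char[of "?\<Psi> q" q]) (use f in \<open>simp_all add: weak_chains_def\<close>)
      moreover have "\<forall>s\<in>{1..n}. ?\<Psi> q (base \<pi> s) mod r = col \<pi> s"
        using f in1 by simp
      moreover have "?\<Psi> q \<in> {1..n} \<rightarrow>\<^sub>E {0..r * M}"
      proof
        fix k assume "k \<in> {1..n}"
        then show "?\<Psi> q k \<in> {0..r * M}" using * p[of k] by fastforce
      qed auto
      ultimately show "?\<Psi> q \<in> ?A"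
        unfolding sorts_def by simp
    qed
  qed
  then have "card ?A = card (weak_chains \<delta> n M)" by (rule bij_betw_same_card)
  also have "\<dots> = (M + n - (\<Sum>s=1..n. \<delta> s)) choose n"
    using finite_card_weak_chains[of \<delta>] by (simp add: \<delta>_def)
  also have "(\<Sum>s=1..n. \<delta> s) = des n \<pi>"
    unfolding \<delta>_def des_def by (simp add: sum.If_cases of_bool_def Int_def)
  finally show ?thesis .
qed

section \<open>Existence and uniqueness of the sorting permutation\<close>

text \<open>The word is extended to all letters by shifting colors modulo \<open>r\<close>. The
  resulting map is onto the finite set of letters, hence a bijection.\<close>

lemma ex_colored_perm:
  assumes r: "r \<ge> 1" and p: "bij_betw p {1..n} {1..n}" and c: "\<And>s. s \<in> {1..n} \<Longrightarrow> c s < r"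
  obtains \<pi> where "\<pi> \<in> colored_perms r n" "\<And>s. s \<in> {1..n} \<Longrightarrow> base \<pi> s = p s \<and> col \<pi> s = c s"
proof -
  define F where "F x = (if x \<in> letters r n then (p (fst x), (c (fst x) + snd x) mod r) else x)" for x
  have pin: "p s \<in> {1..n}" if "s \<in> {1..n}" for s
    using p that by (auto simp: bij_betw_def)
  have maps: "F ` letters r n \<subseteq> letters r n"
  proof (rule image_subsetI)
    fix x assume x: "x \<in> letters r n"
    then have "p (fst x) \<in> {1..n}" using pin by (auto simp: letters_def)
    then show "F x \<in> letters r n" using x r by (simp add: F_def letters_def)
  qed
  have "letters r n \<subseteq> F ` letters r n"
  proof
    fix y assume y: "y \<in> letters r n"
    obtain k d where kd: "y = (k, d)" "k \<in> {1..n}" "d < r" using y by (auto simp: letters_def)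
    obtain s where s: "s \<in> {1..n}" "p s = k" using p kd by (metis bij_betw_iff_bijections)
    \<comment> \<open>This is \<open>d - c s\<close> modulo \<open>r\<close>, with \<open>r\<close>
      added to stay within the naturals.\<close>
    define a where "a = (d + (r - c s)) mod r"
    have "(c s + a) mod r = d"
      using c[OF s(1)] kd(3) unfolding a_def mod_add_right_eq by simp
    moreover have "(s, a) \<in> letters r n" using s r by (simp add: letters_def a_def)
    ultimately show "y \<in> F ` letters r n"
      by (intro image_eqI[of _ _ "(s, a)"]) (simp_all add: F_def kd s)
  qed
  then have surj: "F ` letters r n = letters r n" using maps by blast
  have fin: "finite (letters r n)" by (simp add: letters_def)
  then have "bij_betw F (letters r n) (letters r n)"
    using surj by (simp add: bij_betw_def eq_card_imp_inj_on)
  then have "F permutes letters r n"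
    by (rule bij_imp_permutes) (simp add: F_def)
  then have "bij F" by (rule permutes_bij)
  have sub: "{x. F x \<noteq> x} \<subseteq> letters r n" by (auto simp: F_def)
  then have "F \<in> {f. bij f \<and> finite {a. f a \<noteq> a}}"
    using \<open>bij F\<close> fin by (auto intro: finite_subset)
  then have ap: "Perm F \<langle>$\<rangle> x = F x" for x by (simp add: Perm_inverse)
  have F0: "F (s, a) = (p s, (c s + a) mod r)" if "s \<in> {1..n}" "a < r" for s a
    using that r by (simp add: F_def letters_def)
  show thesis
  proof (rule that)
    show "Perm F \<in> colored_perms r n"
      using sub r c by (auto simp: colored_perms_def in_affected ap F0)
    show "base (Perm F) s = p s \<and> col (Perm F) s = c s" if "s \<in> {1..n}" for s
      using that r c by (simp add: base_def col_def ap F0)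
  qed
qed

lemma colored_perms_eqI:
  assumes "\<pi> \<in> colored_perms r n" "\<pi>' \<in> colored_perms r n"
    and "\<And>s. s \<in> {1..n} \<Longrightarrow> base \<pi> s = base \<pi>' s \<and> col \<pi> s = col \<pi>' s"
  shows "\<pi> = \<pi>'"
proof (rule perm_eqI)
  fix x show "\<pi> \<langle>$\<rangle> x = \<pi>' \<langle>$\<rangle> x"
  proof (cases "x \<in> letters r n")
    case True
    then obtain s a where "x = (s, a)" "s \<in> {1..n}" "a < r" by (auto simp: letters_def)
    then show ?thesis using colored_perms_apply assms by metis
  next
    case False
    then have "x \<notin> affected \<pi>" "x \<notin> affected \<pi>'"
      using assms(1,2) by (auto simp: colored_perms_def)
    then show ?thesis by (simp add: in_affected)
  qed
qed

text \<open>The keys are distinct, so the values can be listed in increasing order of their keys and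
  colored by their labels modulo \<open>r\<close>.\<close>

lemma ex_sorts:
  assumes r: "r \<ge> 1"
  obtains \<pi> where "\<pi> \<in> colored_perms r n" "sorts r n \<pi> f"
proof -
  define N where "N k = f k * (n + 1) + k" for k
  have inj: "inj_on N {1..n}"
    by (rule inj_onI) (simp only: N_def key_eq_iff atLeastAtMost_iff)
  then have card: "card (N ` {1..n}) = n" by (simp add: card_image)
  obtain h where h: "bij_betw h {..<n} (N ` {1..n})" "strict_mono_on {..<n} h"
    using ex_bij_betw_strict_mono_card[of "N ` {1..n}"] card by auto
  \<comment> \<open>\<open>h\<close> enumerates the keys from index 0, while positions in the word
    start at 1.\<close>
  define p where "p s = inv_into {1..n} N (h (s - 1))" for s
  have p: "p s \<in> {1..n}" "N (p s) = h (s - 1)" if "s \<in> {1..n}" for s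
  proof -
    have "h (s - 1) \<in> N ` {1..n}" using h(1) that by (auto simp: bij_betw_def)
    then show "p s \<in> {1..n}" "N (p s) = h (s - 1)"
      unfolding p_def by (rule inv_into_into, rule f_inv_into_f)
  qed
  have mono: "strict_mono_on {1..n} (\<lambda>s. N (p s))"
  proof (rule strict_mono_onI)
    fix s t assume "s \<in> {1..n}" "t \<in> {1..n}" "s < t"
    moreover from this have "h (s - 1) < h (t - 1)"
      by (intro strict_mono_onD[OF h(2)]) auto
    ultimately show "N (p s) < N (p t)" by (simp only: p)
  qed
  then have "inj_on (N \<circ> p) {1..n}"
    unfolding comp_def by (rule strict_mono_on_imp_inj_on)
  then have "inj_on p {1..n}" by (rule inj_on_imageI2)
  then have "bij_betw p {1..n} {1..n}"
    unfolding bij_betw_def by (metis endo_inj_surj finite_atLeastAtMost image_subsetI p(1))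
  then obtain \<pi> where \<pi>: "\<pi> \<in> colored_perms r n"
      "\<And>s. s \<in> {1..n} \<Longrightarrow> base \<pi> s = p s \<and> col \<pi> s = f (p s) mod r"
    using ex_colored_perm[OF r, of p n "\<lambda>s. f (p s) mod r"] r by auto
  have "sorts r n \<pi> f"
    unfolding sorts_def strict_mono_on_def
    using \<pi>(2) mono by (auto simp: N_def strict_mono_on_def)
  with \<pi>(1) show thesis by (rule that)
qed

text \<open>At a first disagreement, the smaller of the two values would have to occur earlier in
  the other enumeration, where both agree.\<close>

lemma strict_mono_on_image_eq:
  fixes g g' :: "nat \<Rightarrow> 'a::linorder"
  assumes "strict_mono_on S g" "strict_mono_on S g'" "g ` S = g' ` S" "s \<in> S"
  shows "g s = g' s"
  using assms(4)
proof (induction s rule: less_induct)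
  case (less s)
  \<comment> \<open>Stated for an arbitrary pair so that it covers both \<open>g s < g' s\<close>
    and \<open>g' s < g s\<close>.\<close>
  have False
    if mono: "strict_mono_on S g1" "strict_mono_on S g2" and "g1 ` S = g2 ` S"
      and IH: "\<And>t. t < s \<Longrightarrow> t \<in> S \<Longrightarrow> g1 t = g2 t" and less': "g1 s < g2 s" for g1 g2 :: "nat \<Rightarrow> 'a"
  proof -
    obtain t where t: "t \<in> S" "g1 s = g2 t"
      using \<open>g1 ` S = g2 ` S\<close> less.prems by (metis imageE imageI)
    then have "t < s"
      using less' strict_mono_on_less[OF mono(2)] less.prems by simp
    then have "g1 t = g1 s" using IH t by simp
    then have "t = s" using strict_mono_on_eqD[OF mono(1)] t(1) less.prems by blast
    then show False using \<open>t < s\<close> by simp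
  qed
  from this[of g g'] this[of g' g] show ?case
    using assms(1-3) less.IH by (metis linorder_neqE)
qed

text \<open>Along both words the keys enumerate the same set increasingly, so they coincide. A key
  determines the value, and the label of that value determines the color.\<close>

lemma sorts_unique:
  assumes r: "r \<ge> 1" and \<pi>: "\<pi> \<in> colored_perms r n" "\<pi>' \<in> colored_perms r n"
    and f: "sorts r n \<pi> f" "sorts r n \<pi>' f"
  shows "\<pi> = \<pi>'"
proof (rule colored_perms_eqI[OF \<pi>])
  fix s assume s: "s \<in> {1..n}"
  define N where "N k = f k * (n + 1) + k" for k
  have img: "(\<lambda>s. N (base \<rho> s)) ` {1..n} = N ` {1..n}" if "\<rho> \<in> colored_perms r n" for \<rho>
    using bij_betw_base[OF that r] by (metis bij_betw_imp_surj_on image_image)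
  have "N (base \<pi> s) = N (base \<pi>' s)"
    by (rule strict_mono_on_image_eq[of "{1..n}"])
      (use f img \<pi> s in \<open>simp_all add: sorts_def N_def\<close>)
  then have "base \<pi> s = base \<pi>' s"
    using colored_perms_letter(1)[OF \<pi>(1) r s] colored_perms_letter(1)[OF \<pi>(2) r s]
    unfolding N_def by (subst (asm) key_eq_iff) auto
  then show "base \<pi> s = base \<pi>' s \<and> col \<pi> s = col \<pi>' s"
    using f s unfolding sorts_def by metis
qed

section \<open>Composition of labellings and the identity at natural numbers\<close>

text \<open>Because \<open>f\<close> is at most \<open>r * a\<close>, comparing \<open>h\<close>
  means comparing \<open>g\<close> first and \<open>f\<close> second. Ties in \<open>g\<close> are
  ordered by the position \<open>t\<close> along \<tau>, and \<sigma> orders the pairs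
  \<open>(f k, k)\<close> by that same position.\<close>

lemma sorts_times:
  assumes r: "r \<ge> 1" and \<sigma>: "\<sigma> \<in> colored_perms r n" and \<tau>: "\<tau> \<in> colored_perms r n"
    and f: "sorts r n \<sigma> f" and g: "sorts r n \<tau> g"
    and fa: "\<And>k. k \<in> {1..n} \<Longrightarrow> f k \<le> r * a"
    and h: "\<And>t. t \<in> {1..n} \<Longrightarrow> h (base \<sigma> t) = (r * a + 1) * g t + f (base \<sigma> t)"
  shows "sorts r n (\<sigma> * \<tau>) h"
proof -
  note in\<sigma> = colored_perms_letter(1)[OF \<sigma> r] and in\<tau> = colored_perms_letter(1)[OF \<tau> r]
  have pc: "base (\<sigma> * \<tau>) s = base \<sigma> (base \<tau> s)"
      "col (\<sigma> * \<tau>) s = (col \<tau> s + col \<sigma> (base \<tau> s)) mod r" if "s \<in> {1..n}" for s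
    using colored_perms_times_apply[OF \<sigma> that r \<tau>, of "base \<tau> s" "col \<tau> s"
        "base \<sigma> (base \<tau> s)" "col \<sigma> (base \<tau> s)"]
    by (simp_all add: base_def col_def)
  have "h (base (\<sigma> * \<tau>) s) mod r = col (\<sigma> * \<tau>) s" if s: "s \<in> {1..n}" for s
  proof -
    let ?t = "base \<tau> s"
    \<comment> \<open>Since \<open>r * a + 1\<close> is 1 modulo \<open>r\<close>, the label is
      congruent to the sum of the two labels, just as colors add in the product.\<close>
    have "h (base (\<sigma> * \<tau>) s) = g ?t + f (base \<sigma> ?t) + r * (a * g ?t)"
      using h in\<tau> s pc by (simp add: algebra_simps)
    then have "h (base (\<sigma> * \<tau>) s) mod r = (g ?t + f (base \<sigma> ?t)) mod r"
      by simp
    also have "\<dots> = (g ?t mod r + f (base \<sigma> ?t) mod r) mod r"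
      by (simp add: mod_simps)
    also have "g ?t mod r = col \<tau> s" using g s by (simp add: sorts_def)
    also have "f (base \<sigma> ?t) mod r = col \<sigma> ?t" using f in\<tau>[OF s] by (simp add: sorts_def)
    finally show ?thesis using pc s by simp
  qed
  moreover have "strict_mono_on {1..n} (\<lambda>s. h (base (\<sigma> * \<tau>) s) * (n + 1) + base (\<sigma> * \<tau>) s)"
  proof (rule strict_mono_onI)
    fix s s' assume s: "s \<in> {1..n}" "s' \<in> {1..n}" "s < s'"
    define t t' where "t = base \<tau> s" and "t' = base \<tau> s'"
    define k k' where "k = base \<sigma> t" and "k' = base \<sigma> t'"
    have t: "t \<in> {1..n}" "t' \<in> {1..n}" using in\<tau> s by (auto simp: t_def t'_def)
    then have k: "k \<in> {1..n}" "k' \<in> {1..n}" using in\<sigma> by (auto simp: k_def k'_def)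
    have le: "t \<le> n" "t' \<le> n" "k \<le> n" "k' \<le> n" using t k by auto
    have "g t * (n + 1) + t < g t' * (n + 1) + t'"
      using strict_mono_onD[OF conjunct1[OF g[unfolded sorts_def]] s] by (simp only: t_def t'_def)
    then have gt: "g t < g t' \<or> g t = g t' \<and> t < t'"
      by (simp only: key_less_iff[OF le(1,2)])
    have "f k < f k' \<or> f k = f k' \<and> k < k'" if "t < t'"
    proof -
      have "f k * (n + 1) + k < f k' * (n + 1) + k'"
        using strict_mono_onD[OF conjunct1[OF f[unfolded sorts_def]] t that] by (simp only: k_def k'_def)
      then show ?thesis by (simp only: key_less_iff[OF le(3,4)])
    qed
    moreover have hk: "h k = (r * a + 1) * g t + f k" "h k' = (r * a + 1) * g t' + f k'"
      using h t by (simp_all add: k_def k'_def)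
    moreover have "h k < h k'" if "g t < g t'"
      using mult_le_mono2[of "Suc (g t)" "g t'" "r * a + 1"] that fa[OF k(1)] unfolding hk by simp
    ultimately have "h k < h k' \<or> h k = h k' \<and> k < k'" using gt by auto
    then show "h (base (\<sigma> * \<tau>) s) * (n + 1) + base (\<sigma> * \<tau>) s < h (base (\<sigma> * \<tau>) s') * (n + 1) + base (\<sigma> * \<tau>) s'"
      unfolding pc(1)[OF s(1)] pc(1)[OF s(2)] t_def[symmetric] t'_def[symmetric]
        k_def[symmetric] k'_def[symmetric] by (simp only: key_less_iff[OF le(3,4)])
  qed
  ultimately show ?thesis by (simp add: sorts_def)
qed

text \<open>Both sides count labellings sorted by \<pi>. The left side groups them by the
  factorizations \<open>\<pi> = \<sigma> * \<tau>\<close>, so that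
  \<open>\<tau> = inverse \<sigma> * \<pi>\<close>.\<close>

lemma binomial_convolution:
  assumes r: "r \<ge> 1" and \<pi>: "\<pi> \<in> colored_perms r n"
  shows "(\<Sum>\<sigma>\<in>colored_perms r n. ((a + n - des n \<sigma>) choose n) * ((b + n - des n (inverse \<sigma> * \<pi>)) choose n)) =
    (r * a * b + a + b + n - des n \<pi>) choose n"
proof -
  define A where "A M \<rho> = {f \<in> {1..n} \<rightarrow>\<^sub>E {0..r * M}. sorts r n \<rho> f}" for M \<rho>
  have finA: "finite (A M \<rho>)" for M \<rho>
    unfolding A_def by (intro finite_subset[OF _ finite_PiE[of "{1..n}" "\<lambda>_. {0..r * M}"]]) auto
  \<comment> \<open>\<open>inv_into\<close> finds the position of the value \<open>k\<close> in the
    word of \<sigma>, which is the argument that \<open>g\<close> needs.\<close>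
  define \<Theta> where "\<Theta> = (\<lambda>(\<sigma>, f, g). restrict (\<lambda>k. (r * a + 1) * g (inv_into {1..n} (base \<sigma>) k) + f k) {1..n})"
  let ?T = "SIGMA \<sigma>:colored_perms r n. A a \<sigma> \<times> A b (inverse \<sigma> * \<pi>)"
  let ?M = "r * a * b + a + b"
  have pinv: "inv_into {1..n} (base \<sigma>) k \<in> {1..n}" "base \<sigma> (inv_into {1..n} (base \<sigma>) k) = k"
    if "\<sigma> \<in> colored_perms r n" "k \<in> {1..n}" for \<sigma> k
    using bij_betw_base[OF that(1) r] that(2)
    by (metis bij_betw_def inv_into_into, metis bij_betw_inv_into_right)
  have pinv': "inv_into {1..n} (base \<sigma>) (base \<sigma> t) = t" if "\<sigma> \<in> colored_perms r n" "t \<in> {1..n}" for \<sigma> t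
    using bij_betw_base[OF that(1) r] that(2) by (metis bij_betw_inv_into_left)
  have \<Theta>_base: "\<Theta> (\<sigma>, f, g) (base \<sigma> t) = (r * a + 1) * g t + f (base \<sigma> t)"
    if "\<sigma> \<in> colored_perms r n" "t \<in> {1..n}" for \<sigma> f g t
    using colored_perms_letter(1)[OF that(1) r that(2)] pinv'[OF that] by (simp add: \<Theta>_def)
  \<comment> \<open>The two ranges fit exactly because
    \<open>(r * a + 1) * (r * b + 1) = r * ?M + 1\<close>.\<close>
  have bound: "x \<le> r * b \<longleftrightarrow> (r * a + 1) * x + y \<le> r * ?M" if "y \<le> r * a" for x y
  proof
    assume "x \<le> r * b"
    then have "(r * a + 1) * x \<le> (r * a + 1) * (r * b)" by (rule mult_le_mono2)
    then show "(r * a + 1) * x + y \<le> r * ?M" using that by (simp add: algebra_simps)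
  next
    assume *: "(r * a + 1) * x + y \<le> r * ?M"
    show "x \<le> r * b"
    proof (rule ccontr)
      assume "\<not> x \<le> r * b"
      then have "(r * a + 1) * Suc (r * b) \<le> (r * a + 1) * x" by (intro mult_le_mono2) simp
      then show False using * by (simp add: algebra_simps)
    qed
  qed
  have inj: "inj_on \<Theta> ?T"
  proof (rule inj_onI)
    fix x x' assume x: "x \<in> ?T" "x' \<in> ?T" and "\<Theta> x = \<Theta> x'"
    obtain \<sigma> f g \<sigma>' f' g' where xs: "x = (\<sigma>, f, g)" "x' = (\<sigma>', f', g')" by (metis surj_pair)
    have \<sigma>: "\<sigma> \<in> colored_perms r n" "\<sigma>' \<in> colored_perms r n"
      and f: "f \<in> A a \<sigma>" "f' \<in> A a \<sigma>'"
      and g: "g \<in> A b (inverse \<sigma> * \<pi>)" "g' \<in> A b (inverse \<sigma>' * \<pi>)"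
      and eq: "\<Theta> (\<sigma>, f, g) = \<Theta> (\<sigma>', f', g')"
      using x \<open>\<Theta> x = \<Theta> x'\<close> unfolding xs by auto
    \<comment> \<open>The remainder recovers \<open>f\<close>; then \<open>f\<close> determines
      \<sigma> by \<open>sorts_unique\<close>, and only then can the quotient be read as
      \<open>g\<close>.\<close>
    have mod: "\<Theta> (\<sigma>, f, g) k mod (r * a + 1) = f k" if "f \<in> A a \<sigma>" "k \<in> {1..n}" for \<sigma> f g k
    proof -
      have "f k \<le> r * a" using that by (auto simp: A_def)
      then have "f k < r * a + 1" by simp
      then show ?thesis using that(2) by (simp add: \<Theta>_def mod_mult_self4 del: mult_Suc)
    qed
    have ff: "f = f'"
      by (rule PiE_ext[of f "{1..n}" "\<lambda>_. {0..r * a}" f'])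
        (use f mod eq in \<open>auto simp: A_def\<close>, metis)
    then have ss: "\<sigma> = \<sigma>'" using sorts_unique[OF r \<sigma>, of f] f by (simp add: A_def)
    have "g t = g' t" if "t \<in> {1..n}" for t
    proof -
      have "(r * a + 1) * g t = (r * a + 1) * g' t"
        using \<Theta>_base[OF \<sigma>(1) that, of f g] \<Theta>_base[OF \<sigma>(1) that, of f g'] eq ff ss
        by (metis add_right_cancel)
      then show ?thesis by (simp only: mult_cancel1) simp
    qed
    then have "g = g'"
      by (intro PiE_ext[of g "{1..n}" "\<lambda>_. {0..r * b}" g']) (use g in \<open>auto simp: A_def\<close>)
    with ff ss show "x = x'" by (simp add: xs)
  qed
  have "\<Theta> ` ?T = A ?M \<pi>"
  proof
    show "\<Theta> ` ?T \<subseteq> A ?M \<pi>"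
    proof (rule image_subsetI, clarify)
      fix \<sigma> f g
      assume \<sigma>: "\<sigma> \<in> colored_perms r n" and f: "f \<in> A a \<sigma>" and g: "g \<in> A b (inverse \<sigma> * \<pi>)"
      have fa: "f k \<le> r * a" and gb: "g k \<le> r * b" if "k \<in> {1..n}" for k
        using f g that by (auto simp: A_def)
      have "sorts r n (\<sigma> * (inverse \<sigma> * \<pi>)) (\<Theta> (\<sigma>, f, g))"
      proof (rule sorts_times[OF r \<sigma>])
        show "inverse \<sigma> * \<pi> \<in> colored_perms r n"
          by (intro times_in_colored_perms inverse_in_colored_perms \<sigma> \<pi>)
        show "sorts r n \<sigma> f" "sorts r n (inverse \<sigma> * \<pi>) g"
          using f g by (simp_all add: A_def)
      qed (rule fa \<Theta>_base[OF \<sigma>], assumption)+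
      moreover have "\<Theta> (\<sigma>, f, g) \<in> {1..n} \<rightarrow>\<^sub>E {0..r * ?M}"
      proof
        fix k assume k: "k \<in> {1..n}"
        then have "\<Theta> (\<sigma>, f, g) k = (r * a + 1) * g (inv_into {1..n} (base \<sigma>) k) + f k"
          by (simp add: \<Theta>_def)
        also have "\<dots> \<le> r * ?M" using bound[OF fa[OF k]] gb[OF pinv(1)[OF \<sigma> k]] by blast
        finally show "\<Theta> (\<sigma>, f, g) k \<in> {0..r * ?M}" by simp
      qed (auto simp: \<Theta>_def)
      ultimately show "\<Theta> (\<sigma>, f, g) \<in> A ?M \<pi>"
        by (simp add: A_def mult.assoc[symmetric])
    qed
    show "A ?M \<pi> \<subseteq> \<Theta> ` ?T"
    proof
      fix h assume h: "h \<in> A ?M \<pi>"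
      \<comment> \<open>The preimage is built in the order of dependence: \<open>f\<close> gives
        \<sigma>, which is needed to index \<open>g\<close>, which gives \<tau>. Uniqueness of
        sorting then forces \<open>\<sigma> * \<tau> = \<pi>\<close>.\<close>
      define f where "f = restrict (\<lambda>k. h k mod (r * a + 1)) {1..n}"
      obtain \<sigma> where \<sigma>: "\<sigma> \<in> colored_perms r n" "sorts r n \<sigma> f" by (rule ex_sorts[OF r])
      define g where "g = restrict (\<lambda>t. h (base \<sigma> t) div (r * a + 1)) {1..n}"
      obtain \<tau> where \<tau>: "\<tau> \<in> colored_perms r n" "sorts r n \<tau> g" by (rule ex_sorts[OF r])
      have fa: "f k \<le> r * a" if "k \<in> {1..n}" for k
        using that mod_less_divisor[of "r * a + 1" "h k"] unfolding f_def by simp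
      have hk: "h (base \<sigma> t) = (r * a + 1) * g t + f (base \<sigma> t)" if "t \<in> {1..n}" for t
        using that colored_perms_letter(1)[OF \<sigma>(1) r that] by (simp add: f_def g_def del: mult_Suc)
      have "sorts r n (\<sigma> * \<tau>) h"
        by (rule sorts_times[OF r \<sigma>(1) \<tau>(1) \<sigma>(2) \<tau>(2) fa hk])
      then have "\<sigma> * \<tau> = \<pi>"
        using sorts_unique[OF r times_in_colored_perms[OF \<sigma>(1) \<tau>(1)] \<pi>] h by (simp add: A_def)
      then have \<tau>_eq: "\<tau> = inverse \<sigma> * \<pi>"
        by (metis mult.assoc mult_1_left perm.left_inverse)
      have "f \<in> A a \<sigma>" using fa \<sigma>(2) by (auto simp: A_def f_def)
      moreover have "g \<in> A b (inverse \<sigma> * \<pi>)"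
      proof -
        have "g t \<le> r * b" if t: "t \<in> {1..n}" for t
        proof -
          have *: "base \<sigma> t \<in> {1..n}" using colored_perms_letter(1)[OF \<sigma>(1) r t] .
          then have "h (base \<sigma> t) \<le> r * ?M" using h by (auto simp: A_def)
          then show ?thesis using bound[OF fa[OF *], of "g t"] hk[OF t] by simp
        qed
        moreover have "g \<in> extensional {1..n}" by (simp add: g_def)
        ultimately show ?thesis using \<tau>(2) by (auto simp: A_def \<tau>_eq PiE_def)
      qed
      moreover have "h = \<Theta> (\<sigma>, f, g)"
      proof
        fix k show "h k = \<Theta> (\<sigma>, f, g) k"
        proof (cases "k \<in> {1..n}")
          case True
          then show ?thesis using hk[OF pinv(1)[OF \<sigma>(1) True]] pinv(2)[OF \<sigma>(1) True]
            by (simp add: \<Theta>_def)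
        next
          case False
          then show ?thesis using h by (auto simp: A_def \<Theta>_def)
        qed
      qed
      ultimately show "h \<in> \<Theta> ` ?T" using \<sigma>(1) by blast
    qed
  qed
  then have "card ?T = card (A ?M \<pi>)" using card_image[OF inj] by simp
  moreover have "card ?T = (\<Sum>\<sigma>\<in>colored_perms r n. card (A a \<sigma>) * card (A b (inverse \<sigma> * \<pi>)))"
    using finite_colored_perms finA by (simp add: card_SigmaI card_cartesian_product)
  ultimately show ?thesis
    unfolding A_def using card_sorts[OF _ r] \<pi> times_in_colored_perms inverse_in_colored_perms by simp
qed

section \<open>From natural numbers to arguments in an integral domain\<close>

abbreviation falling :: "'a::comm_ring_1 \<Rightarrow> nat \<Rightarrow> 'a" where
  "falling z n \<equiv> \<Prod>i<n. z - of_nat i"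

text \<open>Multiplying by the factorial avoids division, so the formula makes sense in every
  commutative ring. The recursion also covers \<open>m < n\<close>, where the binomial coefficient
  is 0.\<close>

lemma fact_binomial_eq_falling:
  "of_nat (fact n * (m choose n)) = falling (of_nat m :: 'a::comm_ring_1) n"
proof (induction n)
  case (Suc n)
  have "of_nat (fact (Suc n) * (m choose Suc n)) = of_nat (fact n * (m choose n)) * (of_nat m - of_nat n :: 'a)"
  proof (cases "n \<le> m")
    case True
    have "Suc n * (m choose Suc n) = (m choose n) * (m - n)"
      by (metis binomial_absorb_comp binomial_absorption mult.commute)
    moreover have "fact (Suc n) * (m choose Suc n) = fact n * (Suc n * (m choose Suc n))"
      by (simp add: algebra_simps)
    ultimately have "fact (Suc n) * (m choose Suc n) = fact n * (m choose n) * (m - n)"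
      by (simp only: mult.assoc)
    then show ?thesis
      using True by (simp only: of_nat_mult of_nat_diff)
  qed (simp add: binomial_eq_0)
  then show ?case using Suc.IH by (simp del: fact_Suc)
qed simp

lemma poly_eq_0_if_nat_roots:
  fixes p :: "'a::{idom, ring_char_0} poly"
  assumes "\<And>m. poly p (of_nat m) = 0"
  shows "p = 0"
proof (rule ccontr)
  assume "p \<noteq> 0"
  then have "finite {x. poly p x = 0}" by (rule poly_roots_finite)
  moreover have "range of_nat \<subseteq> {x. poly p x = 0}" using assms by auto
  ultimately have "finite (range (of_nat :: nat \<Rightarrow> 'a))" by (rule finite_subset[rotated])
  then show False using finite_imageD[OF _ inj_of_nat] by auto
qed

text \<open>The integrality of \<open>a\<close> and \<open>b\<close> is removed one variable at a time, so that univariate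
  polynomials suffice.\<close>

lemma falling_identity_from_nat:
  fixes x y :: "'a::{idom, ring_char_0}"
  assumes "\<And>a b. (\<Sum>s\<in>S. falling (of_nat a + u s) n * falling (of_nat b + v s) n) =
      c * falling (of_nat r * of_nat a * of_nat b + of_nat a + of_nat b + w) n"
  shows "(\<Sum>s\<in>S. falling (x + u s) n * falling (y + v s) n) =
      c * falling (of_nat r * x * y + x + y + w) n"
proof -
  have x: "(\<Sum>s\<in>S. falling (x + u s) n * falling (of_nat b + v s) n) =
      c * falling (of_nat r * x * of_nat b + x + of_nat b + w) n" for x b
  proof -
    \<comment> \<open>The difference of the two sides as a polynomial in the first variable alone;
      in the right-hand factors this variable has coefficient \<open>r * b + 1\<close>.\<close>
    define p where "p = (\<Sum>s\<in>S. (\<Prod>i<n. [:u s - of_nat i, 1:]) * [:falling (of_nat b + v s) n:]) -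
      [:c:] * (\<Prod>i<n. [:of_nat b + w - of_nat i, of_nat r * of_nat b + 1:])"
    have p: "poly p z = (\<Sum>s\<in>S. falling (z + u s) n * falling (of_nat b + v s) n) -
        c * falling (of_nat r * z * of_nat b + z + of_nat b + w) n" for z
      by (simp add: p_def poly_sum poly_prod algebra_simps)
    have "p = 0" by (rule poly_eq_0_if_nat_roots) (simp only: p assms diff_self)
    with p[of x] show ?thesis by simp
  qed
  \<comment> \<open>The same in the second variable, with \<open>x\<close> now an arbitrary ring
    element.\<close>
  define q where "q = (\<Sum>s\<in>S. [:falling (x + u s) n:] * (\<Prod>i<n. [:v s - of_nat i, 1:])) -
      [:c:] * (\<Prod>i<n. [:x + w - of_nat i, of_nat r * x + 1:])"
  have q: "poly q z = (\<Sum>s\<in>S. falling (x + u s) n * falling (z + v s) n) -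
      c * falling (of_nat r * x * z + x + z + w) n" for z
    by (simp add: q_def poly_sum poly_prod algebra_simps)
  have "q = 0" by (rule poly_eq_0_if_nat_roots) (simp only: q x diff_self)
  with q[of y] show ?thesis by simp
qed

section \<open>Transfer to the noncommutative group algebra\<close>

lemma poly_mapping_induct [case_names single add]:
  fixes p :: "'a \<Rightarrow>\<^sub>0 'b::monoid_add"
  assumes single: "\<And>k c. P (Poly_Mapping.single k c)"
    and add: "\<And>p q. P p \<Longrightarrow> P q \<Longrightarrow> P (p + q)"
  shows "P p"
proof (induction p rule: update_induct)
  case const
  show ?case using single[of undefined 0] by simp
next
  case (update f a b)
  have "Poly_Mapping.update a b f = f + Poly_Mapping.single a b"
    using update.hyps(1)
    by (intro poly_mapping_eqI) (auto simp: lookup_update lookup_add lookup_single in_keys_iff when_def)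
  with add[OF update.IH single] show ?case by simp
qed

type_synonym scalar_poly = "(nat \<Rightarrow>\<^sub>0 nat) \<Rightarrow>\<^sub>0 rat"

text \<open>Polynomials with rational coefficients form an integral domain, and \<open>lift\<close> embeds them
  into the (noncommutative) ring \<^typ>\<open>alg_poly\<close>.\<close>

definition lift :: "scalar_poly \<Rightarrow> alg_poly" where
  "lift = Poly_Mapping.map scalar"

lemma scalar_add: "scalar (a + b) = scalar a + scalar b"
  by (simp only: scalar_def single_add)

lemma lift_single: "lift (Poly_Mapping.single k c) = Poly_Mapping.single k (scalar c)"
  by (simp add: lift_def scalar_def)

lemma lookup_lift: "Poly_Mapping.lookup (lift p) k = scalar (Poly_Mapping.lookup p k)"
  by (simp add: lift_def map.rep_eq scalar_def when_def)

lemma lift_add: "lift (p + q) = lift p + lift q"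
  by (rule poly_mapping_eqI) (simp only: lookup_lift lookup_add scalar_add)

text \<open>Both sides are additive in each factor, so comparing monomials suffices.\<close>

lemma lift_mult: "lift (p * q) = lift p * lift q"
proof (induction p rule: poly_mapping_induct)
  case (single k c)
  show ?case
    by (induction q rule: poly_mapping_induct)
      (simp_all add: lift_single lift_add mult_single distrib_left scalar_def)
qed (simp add: lift_add distrib_right)

lemma lift_of_nat: "lift (of_nat m) = of_nat m"
  using lift_single[of 0 "of_nat m"] by (simp add: scalar_def)

lemma lift_diff: "lift (p - q) = lift p - lift q"
  using lift_add[of "p - q" q] by simp

lemma lift_sum: "lift (sum f S) = (\<Sum>s\<in>S. lift (f s))"
  using lift_of_nat[of 0] by (induction S rule: infinite_finite_induct) (simp_all add: lift_add)

text \<open>Turns the commutative product into the ordered product used by \<open>binom\<close>; the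
  instance of \<open>lift_of_nat\<close> at 1 handles the empty product.\<close>

lemma lift_falling: "lift (falling z n) = prod_list (map (\<lambda>i. lift z - of_nat i) [0..<n])"
  using lift_of_nat[of 1] by (induction n) (simp_all add: lift_mult lift_diff lift_of_nat)

text \<open>Lifted coefficients are supported at the group identity, which commutes with every
  \<pi>.\<close>

lemma lift_basis_commute: "Const (basis \<pi>) * lift p = lift p * Const (basis \<pi>)"
proof (induction p rule: poly_mapping_induct)
  case (single k c)
  show ?case
    by (simp add: Const_def basis_def lift_single scalar_def mult_single zero_expo_def)
qed (simp add: lift_add distrib_left distrib_right)

text \<open>The coefficient of \<pi> in \<open>phi\<close>, computed in an integral domain. The
  shift is bracketed to match the form \<open>x + u s\<close> in
  \<open>falling_identity_from_nat\<close>.\<close>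

definition binom_coeff :: "nat \<Rightarrow> letter perm \<Rightarrow> scalar_poly \<Rightarrow> scalar_poly" where
  "binom_coeff n \<pi> z =
     Poly_Mapping.single 0 (1 / fact n) * falling (z + (of_nat n - of_nat (des n \<pi>))) n"

lemma phi_lift:
  "phi r n (lift z) = (\<Sum>\<pi>\<in>colored_perms r n. lift (binom_coeff n \<pi> z) * Const (basis \<pi>))"
  by (simp add: phi_def binom_def binom_coeff_def lift_mult lift_single lift_falling lift_add
      lift_diff lift_of_nat Const_def add_diff_eq)

lemma Const_basis_mult: "Const (basis \<sigma>) * Const (basis \<tau>) = Const (basis (\<sigma> * \<tau>))"
  by (simp add: Const_def basis_def mult_single)

lemma lift_var: "lift (Poly_Mapping.single (Poly_Mapping.single v 1) 1) = Var v"
  by (simp add: lift_single Var_def scalar_def)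

lemma bij_betw_times_colored_perms:
  assumes "\<sigma> \<in> colored_perms r n"
  shows "bij_betw (\<lambda>\<pi>. inverse \<sigma> * \<pi>) (colored_perms r n) (colored_perms r n)"
  using assms
  by (intro bij_betw_byWitness[where f' = "\<lambda>\<tau>. \<sigma> * \<tau>"])
    (auto simp: mult.assoc[symmetric] intro: times_in_colored_perms inverse_in_colored_perms)

text \<open>Expanding the product and substituting \<open>\<tau> = inverse \<sigma> * \<pi>\<close>
  collects the coefficient of each \<pi>.\<close>

lemma phi_lift_mult:
  "phi r n (lift p) * phi r n (lift q) =
     (\<Sum>\<pi>\<in>colored_perms r n.
       lift (\<Sum>\<sigma>\<in>colored_perms r n. binom_coeff n \<sigma> p * binom_coeff n (inverse \<sigma> * \<pi>) q) * Const (basis \<pi>))"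
    (is "_ = ?rhs")
proof -
  let ?G = "colored_perms r n"
  have "phi r n (lift p) * phi r n (lift q) =
      (\<Sum>\<sigma>\<in>?G. \<Sum>\<tau>\<in>?G. lift (binom_coeff n \<sigma> p * binom_coeff n \<tau> q) * Const (basis (\<sigma> * \<tau>)))"
    unfolding phi_lift sum_product lift_mult Const_basis_mult[symmetric]
  proof (intro sum.cong refl)
    fix \<sigma> \<tau>
    let ?P = "lift (binom_coeff n \<sigma> p)" and ?Q = "lift (binom_coeff n \<tau> q)"
    show "?P * Const (basis \<sigma>) * (?Q * Const (basis \<tau>)) = ?P * ?Q * (Const (basis \<sigma>) * Const (basis \<tau>))"
      by (simp only: mult.assoc) (simp only: mult.assoc[symmetric] lift_basis_commute)
  qed
  also have "\<dots> = (\<Sum>\<sigma>\<in>?G. \<Sum>\<pi>\<in>?G.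
      lift (binom_coeff n \<sigma> p * binom_coeff n (inverse \<sigma> * \<pi>) q) * Const (basis \<pi>))"
  proof (rule sum.cong[OF refl])
    fix \<sigma> assume "\<sigma> \<in> ?G"
    note bij = bij_betw_times_colored_perms[OF this]
    have "\<sigma> * (inverse \<sigma> * \<pi>) = \<pi>" for \<pi>
      by (simp only: mult.assoc[symmetric] perm.right_inverse mult_1_left)
    then show "(\<Sum>\<tau>\<in>?G. lift (binom_coeff n \<sigma> p * binom_coeff n \<tau> q) * Const (basis (\<sigma> * \<tau>))) =
      (\<Sum>\<pi>\<in>?G. lift (binom_coeff n \<sigma> p * binom_coeff n (inverse \<sigma> * \<pi>) q) * Const (basis \<pi>))"
      using sum.reindex_bij_betw[OF bij, of "\<lambda>\<tau>. lift (binom_coeff n \<sigma> p * binom_coeff n \<tau> q) * Const (basis (\<sigma> * \<tau>))"]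
      by simp
  qed
  also have "\<dots> = ?rhs"
    by (subst sum.swap) (simp add: lift_sum sum_distrib_right)
  finally show ?thesis .
qed

section \<open>The convolution identity for the coefficients\<close>

lemma des_le: "des n \<pi> \<le> n"
proof -
  have "des n \<pi> \<le> card {1..n}" unfolding des_def by (intro card_mono) auto
  then show ?thesis by simp
qed

text \<open>By \<open>des_le\<close> the subtraction of naturals is exact, so it agrees with
  subtraction in the ring.\<close>

lemma falling_des:
  "falling (of_nat a + (of_nat n - of_nat (des n \<pi>)) :: 'a::comm_ring_1) n =
     of_nat (fact n * ((a + n - des n \<pi>) choose n))"
  using des_le[of n \<pi>] by (simp only: fact_binomial_eq_falling) (simp add: of_nat_diff add_diff_eq)

text \<open>At natural numbers this is \<open>binomial_convolution\<close> multiplied by the square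
  of \<open>fact n\<close>; one factorial is absorbed into the falling product on the right.\<close>

lemma falling_convolution:
  fixes x y :: "'a::{idom, ring_char_0}"
  assumes "r \<ge> 1" "\<pi> \<in> colored_perms r n"
  shows "(\<Sum>\<sigma>\<in>colored_perms r n. falling (x + (of_nat n - of_nat (des n \<sigma>))) n *
      falling (y + (of_nat n - of_nat (des n (inverse \<sigma> * \<pi>)))) n) =
    of_nat (fact n) * falling (of_nat r * x * y + x + y + (of_nat n - of_nat (des n \<pi>))) n"
proof (rule falling_identity_from_nat)
  fix a b
  let ?c = "\<lambda>a \<sigma>. (a + n - des n \<sigma>) choose n"
  have "(\<Sum>\<sigma>\<in>colored_perms r n. falling (of_nat a + (of_nat n - of_nat (des n \<sigma>))) n *
      falling (of_nat b + (of_nat n - of_nat (des n (inverse \<sigma> * \<pi>)))) n) =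
    (of_nat (fact n * fact n * (\<Sum>\<sigma>\<in>colored_perms r n. ?c a \<sigma> * ?c b (inverse \<sigma> * \<pi>))) :: 'a)"
    unfolding falling_des by (simp only: of_nat_mult of_nat_sum sum_distrib_left mult_ac)
  also have "\<dots> = of_nat (fact n) * of_nat (fact n * ?c (r * a * b + a + b) \<pi>)"
    unfolding binomial_convolution[OF assms] by (simp only: of_nat_mult mult.assoc)
  also have "\<dots> = of_nat (fact n) *
      falling (of_nat r * of_nat a * of_nat b + of_nat a + of_nat b + (of_nat n - of_nat (des n \<pi>))) n"
    unfolding falling_des[symmetric] by (simp only: of_nat_add of_nat_mult)
  finally show "(\<Sum>\<sigma>\<in>colored_perms r n. falling (of_nat a + (of_nat n - of_nat (des n \<sigma>))) n *
      falling (of_nat b + (of_nat n - of_nat (des n (inverse \<sigma> * \<pi>)))) n) = of_nat (fact n) *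
      falling (of_nat r * of_nat a * of_nat b + of_nat a + of_nat b + (of_nat n - of_nat (des n \<pi>)) :: 'a) n" .
qed

lemma binom_coeff_convolution:
  assumes "r \<ge> 1" "\<pi> \<in> colored_perms r n"
  shows "(\<Sum>\<sigma>\<in>colored_perms r n. binom_coeff n \<sigma> x * binom_coeff n (inverse \<sigma> * \<pi>) y) =
    binom_coeff n \<pi> (of_nat r * x * y + x + y)"
proof -
  let ?c = "Poly_Mapping.single 0 (1 / fact n) :: scalar_poly"
  \<comment> \<open>Two factors \<open>1 / fact n\<close> stand on the left; one cancels the
    remaining factorial and the other belongs to \<open>binom_coeff\<close> on the right.\<close>
  have c: "?c * of_nat (fact n) = 1"
    by (simp only: single_of_nat[symmetric] mult_single) simp
  have "(\<Sum>\<sigma>\<in>colored_perms r n. binom_coeff n \<sigma> x * binom_coeff n (inverse \<sigma> * \<pi>) y) =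
    ?c * ?c * (\<Sum>\<sigma>\<in>colored_perms r n. falling (x + (of_nat n - of_nat (des n \<sigma>))) n *
      falling (y + (of_nat n - of_nat (des n (inverse \<sigma> * \<pi>)))) n)"
    unfolding binom_coeff_def by (simp only: sum_distrib_left mult_ac)
  also have "\<dots> = ?c * of_nat (fact n) * binom_coeff n \<pi> (of_nat r * x * y + x + y)"
    unfolding falling_convolution[OF assms] binom_coeff_def by (simp only: mult_ac)
  finally show ?thesis by (simp only: c mult_1_left)
qed

theorem theorem3p5p7:
  fixes r n :: nat
  assumes "r \<ge> 1" and "n \<ge> 1"
  shows "phi r n (Var 0) * phi r n (Var 1) =
    phi r n (of_nat r * Var 0 * Var 1 + Var 0 + Var 1)"
proof -
  define X Y :: scalar_poly
    where "X = Poly_Mapping.single (Poly_Mapping.single 0 1) 1"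
      and "Y = Poly_Mapping.single (Poly_Mapping.single 1 1) 1"
  have XY: "Var 0 = lift X" "Var 1 = lift Y"
    by (simp_all only: X_def Y_def lift_var)
  have "phi r n (lift X) * phi r n (lift Y) = phi r n (lift (of_nat r * X * Y + X + Y))"
    \<comment> \<open>The product is rewritten first, since \<open>phi_lift\<close> would otherwise
      expand its factors; then the coefficients are compared for each \<pi>.\<close>
    unfolding phi_lift_mult unfolding phi_lift
    by (intro sum.cong refl) (simp only: binom_coeff_convolution[OF assms(1)])
  then show ?thesis
    by (simp only: XY lift_add lift_mult lift_of_nat)
qed

end
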